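(* Let $p\ge 1$, let $\gamma_1,\dots,\gamma_p>0$, and let $b_i\in RV_{1/\gamma_i}$ for $i=1,\dots,p$; write $\boldsymbol b(t)=(b_1(t),\dots,b_p(t))$. Let $U$ be a measure on $\mathbb{R}_+^p$ with $\hat U(\boldsymbol\lambda)<\infty$ for all $\boldsymbol\lambda>\boldsymbol 0$, and let $U_t$ be the rescaled measure determined by $U_t([\boldsymbol 0,\boldsymbol x])=\frac1t U([\boldsymbol 0,\boldsymbol b(t)\boldsymbol x])$. Suppose there exists $U_\infty\in M_+(\mathbb{R}_+^p)$, $U_\infty\not\equiv 0$, such that, as $t\to\infty$, $$U_t\to U_\infty\quad\text{vaguely in } M_+(\mathbb{R}_+^p).$$ Then the functions $\boldsymbol x\mapsto \hat U(\boldsymbol 1/\boldsymbol x)$ and $\boldsymbol x\mapsto\hat U_\infty(\boldsymbol 1/\boldsymbol x)$, $\boldsymbol x>\boldsymbol 0$, are distribution functions of Radon measures on $\mathbb{R}_+^p$ (that is, there are Radon measures $W,W_\infty$ on $\mathbb{R}_+^p$ with $W([\boldsymbol 0,\boldsymbol x])=\hat U(\boldsymbol 1/\boldsymbol x)$ and $W_\infty([\boldsymbol 0,\boldsymbol x])=\hat U_\infty(\boldsymbol 1/\boldsymbol x)$ for all $\boldsymbol x>\boldsymbol 0$). Moreover, these measures inherit the non-standard regular variation: for every $\boldsymbol x>\boldsymbol 0$, $$\frac1t\,\hat U\bigl(\boldsymbol 1/(\boldsymbol b(t)\boldsymbol x)\bigr)\to\hat U_\infty(\boldsymbol 1/\boldsymbol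 x)\qquad (t\to\infty),$$ provided that also, for every $\boldsymbol x>\boldsymbol 0$, $$\lim_{y\to\infty}\limsup_{t\to\infty}\int_{\{\boldsymbol v\in\mathbb{R}_+^p:\ v_i>y\text{ for some }i\}}e^{-\sum_{i=1}^p v_i/x_i}\,U_t(d\boldsymbol v)=0.$$
   Context: Notation. $\mathbb{R}_+=[0,\infty)$. Vectors in $\mathbb{R}_+^p$ are bold, $\boldsymbol x=(x_1,\dots,x_p)$; $\boldsymbol 0=(0,\dots,0)$, $\boldsymbol 1=(1,\dots,1)$. Operations and inequalities between vectors are componentwise: $\boldsymbol x\boldsymbol y=(x_1y_1,\dots,x_py_p)$, $\boldsymbol 1/\boldsymbol x=(1/x_1,\dots,1/x_p)$, and $\boldsymbol x>\boldsymbol 0$ means $x_i>0$ for all $i$. $[\boldsymbol 0,\boldsymbol x]=\{\boldsymbol u: 0\le u_i\le x_i,\ i=1,\dots,p\}$. $M_+(\mathbb{R}_+^p)$ is the set of Radon (locally finite Borel) measures on $\mathbb{R}_+^p$ with the topology of vague convergence: $\mu_t\to\mu$ vaguely if $\int f\,d\mu_t\to\int f\,d\mu$ for every continuous compactly supported $f:\mathbb{R}_+^p\to[0,\infty)$. For a measure $U$ on $\mathbb{R}_+^p$, its Laplace transform is $\hat U(\boldsymbol\lambda)=\int_{\mathbb{R}_+^p}e^{-\sum_{i=1}^p\lambda_i x_i}\,U(d\boldsymbol x)$, $\boldsymbol\lambda>\boldsymbol 0$. (Finiteness of $\hat U$ on $\boldsymbol\lambda>\boldsymbol 0$ implies that $U$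 is Radon.) Equivalently to the definition in the claim, $U_t(A)=\frac1t U(\{\boldsymbol b(t)\boldsymbol x:\boldsymbol x\in A\})$ for Borel $A$. $RV_\beta$, $\beta>0$, is the class of positive functions $b$ on $(0,\infty)$ that are regularly varying at infinity with index $\beta$, i.e. $b(ct)/b(t)\to c^\beta$ as $t\to\infty$ for every $c>0$; by convention, such functions are taken to be continuous and strictly increasing. *)

theory Defs
  imports "HOL-Analysis.Analysis"
begin

text \<open>
  The space \<open>\<real>\<^sub>+\<^sup>p\<close> is \<open>{0..} :: (real^'n) set\<close> with \<open>p = CARD('n)\<close>. On \<open>real^'n\<close> the library's \<open>0\<close>,
  \<open>*\<close> and \<open>\<le>\<close> are componentwise, so \<open>{0..x}\<close> is the box \<open>[0,x]\<close>. The library's \<open><\<close> on vectors is not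
  componentwise, hence \<open>vpos\<close>.
\<close>

abbreviation orthant :: "(real^'n) set" where
  "orthant \<equiv> {0..}"

abbreviation borel_orthant :: "(real^'n) measure" where
  "borel_orthant \<equiv> restrict_space borel orthant"

definition vpos :: "real^'n \<Rightarrow> bool" where
  "vpos x \<longleftrightarrow> (\<forall>i. 0 < x $ i)"

definition vrecip :: "real^'n \<Rightarrow> real^'n" where
  "vrecip x = (\<chi> i. 1 / x $ i)"

definition radon_on_orthant :: "(real^'n) measure \<Rightarrow> bool" where
  "radon_on_orthant M \<longleftrightarrow>
     sets M = sets borel_orthant \<and>
     (\<forall>x\<in>orthant. \<exists>V. open V \<and> x \<in> V \<and> emeasure M (V \<inter> orthant) < \<infinity>)"

text \<open>
  The test functions are only constrained on the orthant. As the orthant is closed, the closure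
  below is the support of the restriction of \<open>f\<close> to it.
\<close>

definition vague_limit ::
  "('t \<Rightarrow> (real^'n) measure) \<Rightarrow> (real^'n) measure \<Rightarrow> 't filter \<Rightarrow> bool" where
  "vague_limit M L F \<longleftrightarrow>
     (\<forall>f :: real^'n \<Rightarrow> real.
        continuous_on orthant f \<longrightarrow> (\<forall>x\<in>orthant. 0 \<le> f x) \<longrightarrow>
        compact (closure {x \<in> orthant. f x \<noteq> 0}) \<longrightarrow>
        ((\<lambda>t. \<integral>\<^sup>+ x. ennreal (f x) \<partial>M t) \<longlongrightarrow> (\<integral>\<^sup>+ x. ennreal (f x) \<partial>L)) F)"

definition laplace :: "(real^'n) measure \<Rightarrow> real^'n \<Rightarrow> ennreal" where
  "laplace U l = (\<integral>\<^sup>+ x. ennreal (exp (- (\<Sum>i\<in>UNIV. l $ i * x $ i))) \<partial>U)"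

text \<open>
  The image of \<open>U\<close> under \<open>u \<mapsto> u / b(t)\<close>, divided by \<open>t\<close>; the two lemmas below give its values on
  Borel sets and on boxes.
\<close>

definition rescaled ::
  "(real^'n) measure \<Rightarrow> (real \<Rightarrow> real^'n) \<Rightarrow> real \<Rightarrow> (real^'n) measure" where
  "rescaled U b t =
     scale_measure (ennreal (1 / t)) (distr U borel_orthant (\<lambda>u. vrecip (b t) * u))"

definition RV :: "real \<Rightarrow> (real \<Rightarrow> real) set" where
  "RV \<beta> = {b. (\<forall>t>0. 0 < b t) \<and> continuous_on {0<..} b \<and> strict_mono_on {0<..} b \<and>
             (\<forall>c>0. ((\<lambda>t. b (c * t) / b t) \<longlongrightarrow> c powr \<beta>) at_top)}"

lemma sets_rescaled: "sets (rescaled U b t) = sets borel_orthant"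
  by (simp add: rescaled_def)

lemma emeasure_rescaled:
  assumes U: "sets U = sets borel_orthant" and b: "vpos (b t)" and A: "A \<in> sets borel_orthant"
  shows "emeasure (rescaled U b t) A = ennreal (1 / t) * emeasure U ((\<lambda>x. b t * x) ` A)"
proof -
  have sp: "space U = orthant"
    using sets_eq_imp_space_eq[OF U] by (simp add: space_restrict_space)
  have bi: "0 < b t $ i" for i using b by (simp add: vpos_def)
  have bn: "b t $ i \<noteq> 0" for i using bi[of i] by simp
  have "(\<lambda>u. vrecip (b t) * u) \<in> borel_measurable borel"
    using bn by (intro borel_measurable_continuous_onI)
      (auto simp: vrecip_def times_vec_def intro!: continuous_intros)
  hence "(\<lambda>u. vrecip (b t) * u) \<in> measurable borel_orthant borel_orthant"
    using bi by (intro measurable_restrict_space3)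
      (auto simp: vrecip_def less_eq_vec_def divide_simps intro: less_imp_le)
  hence m: "(\<lambda>u. vrecip (b t) * u) \<in> measurable U borel_orthant"
    by (simp cong: measurable_cong_sets add: U)
  have A0: "A \<subseteq> orthant" using A sets.sets_into_space[OF A] by (simp add: space_restrict_space)
  have inv: "b t * (vrecip (b t) * u) = u" "vrecip (b t) * (b t * u) = u" for u
    using bn by (auto simp: vec_eq_iff vrecip_def)
  have pos: "0 \<le> b t * x" if "0 \<le> x" for x
    using that bi[THEN less_imp_le] by (auto simp: less_eq_vec_def)
  have "(\<lambda>u. vrecip (b t) * u) -` A \<inter> space U = (\<lambda>x. b t * x) ` A"
  proof (intro set_eqI iffI)
    fix u assume "u \<in> (\<lambda>u. vrecip (b t) * u) -` A \<inter> space U"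
    thus "u \<in> (\<lambda>x. b t * x) ` A" by (intro image_eqI[of _ _ "vrecip (b t) * u"]) (auto simp: inv)
  next
    fix u assume "u \<in> (\<lambda>x. b t * x) ` A"
    thus "u \<in> (\<lambda>u. vrecip (b t) * u) -` A \<inter> space U" using A0 pos by (auto simp: inv sp)
  qed
  thus ?thesis using m A by (simp add: rescaled_def emeasure_distr)
qed

lemma emeasure_rescaled_box:
  assumes U: "sets U = sets borel_orthant" and b: "vpos (b t)"
  shows "emeasure (rescaled U b t) {0..x} = ennreal (1 / t) * emeasure U {0..b t * x}"
proof -
  have bi: "0 < b t $ i" for i using b by (simp add: vpos_def)
  have bn: "b t $ i \<noteq> 0" for i using bi[of i] by simp
  have "{0..x} \<in> sets borel" by simp
  hence A: "{0..x} \<in> sets borel_orthant"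
    by (subst sets_restrict_space_iff) auto
  have "(\<lambda>x. b t * x) ` {0..x} = {0..b t * x}"
  proof (intro set_eqI iffI)
    fix u assume "u \<in> (\<lambda>x. b t * x) ` {0..x}"
    thus "u \<in> {0..b t * x}" using bi[THEN less_imp_le]
      by (auto simp: less_eq_vec_def intro!: mult_nonneg_nonneg mult_left_mono)
  next
    fix u assume "u \<in> {0..b t * x}"
    hence "vrecip (b t) * u \<in> {0..x}" "u = b t * (vrecip (b t) * u)" using bi bn
      by (auto simp: less_eq_vec_def vrecip_def vec_eq_iff
          pos_divide_le_eq mult.commute intro!: divide_nonneg_pos)
    thus "u \<in> (\<lambda>x. b t * x) ` {0..x}" by blast
  qed
  thus ?thesis using emeasure_rescaled[of U b t, OF U b A] by simp
qed

end

theory Submission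
  imports Defs
begin

text \<open>
  There are three claims: \<open>x \<mapsto> laplace U (vrecip x)\<close> and \<open>x \<mapsto> laplace Uinf (vrecip x)\<close> are
  distribution functions of Radon measures, and the rescaled transforms converge.

  For a fixed \<open>u\<close>, the function \<open>x \<mapsto> exp (- (\<Sum>i. u $ i / x $ i))\<close> is the distribution function of
  a random vector with independent Frechet coordinates. Integrated over \<open>U(du)\<close>, it is the
  distribution function of a mixture of such laws, which is Radon exactly when the transform is
  finite (\<open>laplace_vrecip_distribution\<close>).

  To apply this to \<open>Uinf\<close> its transform must be finite, and here regular variation enters. For
  some \<open>c\<close>, passing from \<open>t\<close> to \<open>c t\<close> eventually at least doubles every coordinate of \<open>b\<close>. So the
  rescaled measure at time \<open>t\<close> gives a ball of radius \<open>2 R\<close> at most \<open>c\<close> times the mass that the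
  rescaled measure at time \<open>c t\<close> gives the ball of radius \<open>R\<close>, up to smoothing the indicators of the
  balls. Both measures tend to \<open>Uinf\<close>, which therefore has the doubling property
  (\<open>vague_limit_rescaled_doubling\<close>), grows polynomially, and has a finite Laplace transform
  (\<open>laplace_finite_of_doubling\<close>).

  Since \<open>laplace U (vrecip (b t * x)) / t\<close> is the Laplace transform of the rescaled measure at
  \<open>vrecip x\<close>, the last claim says that Laplace transforms pass to the vague limit. The exponential
  does not have compact support; the tail condition makes up for it
  (\<open>laplace_tendsto_of_vague_limit\<close>).
\<close>

section \<open>Measures on the orthant\<close>

lemma borel_measurable_orthant:
  fixes f :: "real^'n \<Rightarrow> 'b::topological_space"
  assumes "sets M = sets borel_orthant" and "continuous_on UNIV f"
  shows "f \<in> borel_measurable M"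
proof -
  have "f \<in> borel_measurable borel_orthant"
    using assms(2) by (intro measurable_restrict_space1 borel_measurable_continuous_onI)
  thus ?thesis by (simp cong: measurable_cong_sets add: assms(1))
qed

lemma space_eq_orthant:
  assumes "sets M = sets (borel_orthant :: (real^'n) measure)"
  shows "space M = orthant"
  using sets_eq_imp_space_eq[OF assms] by (simp add: space_restrict_space)

lemma sets_orthantI:
  fixes A :: "(real^'n) set"
  assumes "sets M = sets borel_orthant" and "A \<in> sets borel"
  shows "A \<inter> orthant \<in> sets M"
  using assms by (auto simp: sets_restrict_space)

lemma radon_on_orthant_compact_finite:
  fixes M :: "(real^'n) measure"
  assumes M: "radon_on_orthant M" and K: "compact K" "K \<subseteq> orthant"
  shows "emeasure M K < \<infinity>"
proof -
  have sets: "sets M = sets borel_orthant" using M by (simp add: radon_on_orthant_def)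
  have "\<forall>x\<in>K. \<exists>V. open V \<and> x \<in> V \<and> emeasure M (V \<inter> orthant) < \<infinity>"
    using M K by (auto simp: radon_on_orthant_def)
  then obtain V where V: "\<And>x. x \<in> K \<Longrightarrow> open (V x) \<and> x \<in> V x \<and> emeasure M (V x \<inter> orthant) < \<infinity>"
    by metis
  obtain C where C: "C \<subseteq> K" "finite C" "K \<subseteq> (\<Union>x\<in>C. V x)"
    using compactE_image[OF K(1), of K V] V by blast
  have m: "V x \<inter> orthant \<in> sets M" if "x \<in> C" for x
    using V[of x] C that by (intro sets_orthantI[OF sets]) auto
  have "(\<Union>x\<in>C. V x \<inter> orthant) \<in> sets M" using C m by (intro sets.finite_UN) auto
  hence "emeasure M K \<le> emeasure M (\<Union>x\<in>C. V x \<inter> orthant)"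
    using C K by (intro emeasure_mono) auto
  also have "\<dots> \<le> (\<Sum>x\<in>C. emeasure M (V x \<inter> orthant))"
    using C m by (intro emeasure_subadditive_finite) auto
  also have "\<dots> < \<infinity>" using V C by auto
  finally show ?thesis .
qed

lemma radon_on_orthantI:
  fixes W :: "(real^'n) measure"
  assumes W: "sets W = sets borel_orthant" and fin: "\<And>x. vpos x \<Longrightarrow> emeasure W {0..x} < \<infinity>"
  shows "radon_on_orthant W"
  unfolding radon_on_orthant_def
proof (intro conjI ballI W)
  fix x :: "real^'n" assume x: "x \<in> orthant"
  define V where "V = {y :: real^'n. \<forall>i. y $ i < x $ i + 1}"
  have xpos: "vpos (x + 1)"
    using x by (auto simp: vpos_def less_eq_vec_def add_nonneg_pos)
  have V: "open V" unfolding V_def Collect_all_eq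
    by (intro open_INT ballI open_Collect_less continuous_intros) simp
  have "{0..x+1} \<inter> orthant \<in> sets W" by (intro sets_orthantI[OF W]) auto
  hence "emeasure W (V \<inter> orthant) \<le> emeasure W {0..x + 1}"
    by (intro emeasure_mono) (auto simp: V_def less_eq_vec_def less_imp_le Int_absorb2)
  also have "\<dots> < \<infinity>" using fin[OF xpos] .
  finally show "\<exists>V. open V \<and> x \<in> V \<and> emeasure W (V \<inter> orthant) < \<infinity>"
    using V by (intro exI[of _ V]) (auto simp: V_def)
qed

section \<open>Laplace transforms as distribution functions\<close>

text \<open>
  \<open>x \<mapsto> exp (- u / x)\<close> is the Frechet distribution function with scale \<open>u\<close>, and it is the
  distribution function of \<open>- u / ln \<theta>\<close> for \<open>\<theta>\<close> uniform on \<open>(0,1)\<close>. Hence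
  \<open>x \<mapsto> laplace U (vrecip x)\<close> is the mixture over \<open>U(du)\<close> of the distribution functions of vectors
  with independent Frechet coordinates: the image of \<open>U\<close> times the uniform law on the cube under
  \<open>(u, \<theta>) \<mapsto> - u / ln \<theta>\<close>.
\<close>

lemma laplace_vrecip_distribution:
  fixes U :: "(real^'n) measure"
  assumes U: "sets U = sets borel_orthant" and fin: "\<And>l. vpos l \<Longrightarrow> laplace U l < \<infinity>"
  shows "\<exists>W. radon_on_orthant W \<and> (\<forall>x. vpos x \<longrightarrow> emeasure W {0..x} = laplace U (vrecip x))"
proof -
  define E :: "real measure" where "E = restrict_space lborel {0<..<1}"
  have spE: "space E = {0<..<1}" by (simp add: E_def space_restrict_space)
  have setE: "A \<inter> {0<..<1} \<in> sets E" if "A \<in> sets borel" for A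
    using that by (auto simp: E_def sets_restrict_space)
  have emE: "emeasure E ({..exp (- a)} \<inter> {0<..<1}) = ennreal (exp (- a))" if "a \<ge> 0" for a :: real
  proof -
    \<comment> \<open>For \<open>a = 0\<close> the endpoint 1 is missing, because \<open>- u / ln \<theta>\<close> needs \<open>\<theta> < 1\<close>.\<close>
    have "{..exp (- a)} \<inter> {0<..<1} = (if a = 0 then {0<..<1} else {0<..exp (- a)})"
      using that by auto (smt (verit) exp_less_one_iff)
    hence "emeasure lborel ({..exp (- a)} \<inter> {0<..<1}) = ennreal (exp (- a))" by simp
    moreover have "emeasure E ({..exp (- a)} \<inter> {0<..<1}) = emeasure lborel ({..exp (- a)} \<inter> {0<..<1})"
      unfolding E_def by (intro emeasure_restrict_space) auto
    ultimately show ?thesis by simp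
  qed
  interpret E: finite_measure E
    by (rule finite_measureI) (simp add: spE, simp add: E_def emeasure_restrict_space)
  interpret product_sigma_finite "\<lambda>_::'n. E" ..
  define P where "P = PiM (UNIV :: 'n set) (\<lambda>_. E)"
  interpret P: sigma_finite_measure P
    unfolding P_def by (rule sigma_finite) simp
  have spP: "space P = {\<theta>. \<forall>i. 0 < \<theta> i \<and> \<theta> i < 1}"
    by (auto simp: P_def space_PiM PiE_def Pi_def spE extensional_def)
  define g :: "(real^'n) \<times> ('n \<Rightarrow> real) \<Rightarrow> real^'n" where "g = (\<lambda>(u, \<theta>). \<chi> i. - u $ i / ln (\<theta> i))"
  have "g \<in> measurable (U \<Otimes>\<^sub>M P) borel"
  proof (rule borel_measurable_euclidean_space[THEN iffD2], rule ballI)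
    fix v :: "real^'n" assume "v \<in> Basis"
    then obtain i where v: "v = axis i 1" by (auto simp: Basis_vec_def)
    have m1: "(\<lambda>u::real^'n. u $ i) \<in> borel_measurable U"
      by (intro borel_measurable_orthant[OF U] continuous_intros)
    have m0: "(\<lambda>s::real. s) \<in> borel_measurable E"
      unfolding E_def by (intro measurable_restrict_space1) auto
    have "(\<lambda>\<theta>. \<theta> i) \<in> measurable P E"
      unfolding P_def by (rule measurable_component_singleton) simp
    hence m2: "(\<lambda>\<theta>. \<theta> i) \<in> borel_measurable P" using m0 by (rule measurable_compose)
    have "(\<lambda>z. - fst z $ i / ln (snd z i)) \<in> borel_measurable (U \<Otimes>\<^sub>M P)"
      using measurable_compose[OF measurable_fst m1] measurable_compose[OF measurable_snd m2]
      by measurable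
    thus "(\<lambda>z. g z \<bullet> v) \<in> borel_measurable (U \<Otimes>\<^sub>M P)"
      by (simp add: v g_def inner_axis case_prod_unfold)
  qed
  hence g: "g \<in> measurable (U \<Otimes>\<^sub>M P) borel_orthant"
    by (intro measurable_restrict_space2)
      (auto simp: space_pair_measure spP space_eq_orthant[OF U] g_def less_eq_vec_def
        intro!: divide_nonneg_neg)
  define W where "W = distr (U \<Otimes>\<^sub>M P) borel_orthant g"
  have setsW: "sets W = sets borel_orthant" by (simp add: W_def)
  have W: "emeasure W {0..x} = laplace U (vrecip x)" if "vpos x" for x
  proof -
    have xi: "0 < x $ i" for i using that by (simp add: vpos_def)
    have A: "{0..x} \<in> sets borel_orthant"
      using sets_orthantI[of borel_orthant "{0..x}"] by (simp add: Int_absorb2)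
    let ?G = "g -` {0..x} \<inter> space (U \<Otimes>\<^sub>M P)"
    have "emeasure W {0..x} = emeasure (U \<Otimes>\<^sub>M P) ?G"
      unfolding W_def by (rule emeasure_distr[OF g A])
    also have "\<dots> = (\<integral>\<^sup>+ u. emeasure P (Pair u -` ?G) \<partial>U)"
      using g A by (intro P.emeasure_pair_measure_alt) auto
    also have "\<dots> = (\<integral>\<^sup>+ u. ennreal (exp (- (\<Sum>i\<in>UNIV. vrecip x $ i * u $ i))) \<partial>U)"
    proof (rule nn_integral_cong)
      fix u assume "u \<in> space U"
      hence u0: "0 \<le> u" and ui: "0 \<le> u $ i" for i
        using space_eq_orthant[OF U] by (auto simp: less_eq_vec_def)
      have iff: "- u $ i / ln s \<le> x $ i \<longleftrightarrow> s \<le> exp (- (u $ i / x $ i))" if "0 < s" "s < 1" for s i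
      proof -
        have "ln s < 0" using that by simp
        hence "- u $ i / ln s \<le> x $ i \<longleftrightarrow> x $ i * ln s \<le> - u $ i" by (rule neg_divide_le_eq)
        also have "\<dots> \<longleftrightarrow> ln s \<le> - (u $ i / x $ i)" using xi[of i] by (simp add: field_simps)
        also have "\<dots> \<longleftrightarrow> s \<le> exp (- (u $ i / x $ i))" using that(1)
          by (metis exp_le_cancel_iff exp_ln)
        finally show ?thesis .
      qed
      have nn: "0 \<le> - u $ i / ln s" if "0 < s" "s < 1" for s i
        using that ui[of i] by (intro divide_nonpos_neg) auto
      have "Pair u -` ?G = Pi\<^sub>E UNIV (\<lambda>i. {..exp (- (u $ i / x $ i))} \<inter> {0<..<1})"
        using \<open>u \<in> space U\<close> iff nn
        by (auto simp: space_pair_measure spP g_def PiE_def Pi_def extensional_def less_eq_vec_def)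
      hence "emeasure P (Pair u -` ?G) = (\<Prod>i\<in>UNIV. ennreal (exp (- (u $ i / x $ i))))"
        using emE ui xi unfolding P_def
        by (simp add: emeasure_PiM setE less_imp_le)
      also have "\<dots> = ennreal (exp (- (\<Sum>i\<in>UNIV. vrecip x $ i * u $ i)))"
        by (simp add: prod_ennreal exp_sum vrecip_def flip: sum_negf)
      finally show "emeasure P (Pair u -` ?G) = \<dots>" .
    qed
    finally show ?thesis by (simp add: laplace_def)
  qed
  have "vpos (vrecip x)" if "vpos x" for x :: "real^'n" using that by (simp add: vpos_def vrecip_def)
  hence "emeasure W {0..x} < \<infinity>" if "vpos x" for x using W fin that by metis
  hence "radon_on_orthant W" by (rule radon_on_orthantI[OF setsW])
  with W show ?thesis by blast
qed

section \<open>Cutoff functions\<close>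

definition coord_sum :: "real^'n \<Rightarrow> real" where
  "coord_sum v = (\<Sum>i\<in>UNIV. v $ i)"

text \<open>
  On the orthant \<open>coord_sum\<close> is the 1-norm. It increases with each coordinate and hence the cutoffs
  decrease; this is what lets them be compared after a change of scale.
\<close>

definition cutoff :: "real \<Rightarrow> real^'n \<Rightarrow> real" where
  "cutoff R v = max 0 (min 1 (2 - coord_sum v / R))"

lemma continuous_on_cutoff [continuous_intros]: "continuous_on A (cutoff R)"
  unfolding cutoff_def coord_sum_def divide_inverse by (intro continuous_intros)

lemma cutoff_nonneg: "0 \<le> cutoff R v" and cutoff_le_1: "cutoff R v \<le> 1"
  by (auto simp: cutoff_def)

lemma cutoff_eq_1: "0 < R \<Longrightarrow> coord_sum v \<le> R \<Longrightarrow> cutoff R v = 1"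
  by (auto simp: cutoff_def field_simps)

lemma coord_sum_nonneg: "0 \<le> v \<Longrightarrow> 0 \<le> coord_sum v"
  by (auto simp: coord_sum_def less_eq_vec_def intro: sum_nonneg)

lemma cutoff_mono:
  assumes "0 < R" "R \<le> S" shows "cutoff R v \<le> cutoff S v"
proof (cases "coord_sum v \<le> 0")
  case True
  thus ?thesis using assms by (simp add: cutoff_eq_1)
next
  case False
  hence "coord_sum v / S \<le> coord_sum v / R" using assms by (intro divide_left_mono) auto
  thus ?thesis by (auto simp: cutoff_def)
qed

lemma tendsto_cutoff: "(\<lambda>n. cutoff (real (Suc n)) v) \<longlonglongrightarrow> 1"
proof (rule tendsto_eventually)
  have "\<forall>\<^sub>F n in sequentially. coord_sum v \<le> real n"
    using filterlim_real_sequentially by (auto simp: filterlim_at_top)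
  thus "\<forall>\<^sub>F n in sequentially. cutoff (real (Suc n)) v = 1"
    by eventually_elim (auto intro!: cutoff_eq_1)
qed

lemma bounded_orthant_coord_sum: "bounded {v :: real^'n. 0 \<le> v \<and> coord_sum v \<le> R}"
proof (rule boundedI)
  fix v :: "real^'n" assume "v \<in> {v. 0 \<le> v \<and> coord_sum v \<le> R}"
  hence "\<bar>v $ i\<bar> = v $ i" "coord_sum v \<le> R" for i by (auto simp: less_eq_vec_def)
  thus "norm v \<le> R" using norm_le_l1_cart[of v] by (simp add: coord_sum_def)
qed

lemma compact_cutoff_support:
  fixes h :: "real^'n \<Rightarrow> real"
  assumes "0 < R"
  shows "compact (closure {v \<in> orthant. h v * cutoff R v \<noteq> 0})"
proof -
  have "coord_sum v \<le> 2 * R" if "cutoff R v \<noteq> 0" for v :: "real^'n"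
    using that assms by (auto simp: cutoff_def max_def min_def field_simps split: if_splits)
  hence "{v \<in> orthant. h v * cutoff R v \<noteq> 0} \<subseteq> {v :: real^'n. 0 \<le> v \<and> coord_sum v \<le> 2 * R}"
    by auto
  hence "bounded {v \<in> orthant. h v * cutoff R v \<noteq> 0}"
    by (rule bounded_subset[OF bounded_orthant_coord_sum])
  thus ?thesis by (simp add: compact_closure)
qed

lemma vague_limit_cutoff:
  fixes L :: "(real^'n) measure"
  assumes "vague_limit M L F" and "continuous_on UNIV h" and "\<And>v. 0 \<le> h v" and "0 < R"
  shows "((\<lambda>t. \<integral>\<^sup>+ v. ennreal (h v * cutoff R v) \<partial>M t) \<longlongrightarrow>
          (\<integral>\<^sup>+ v. ennreal (h v * cutoff R v) \<partial>L)) F"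
proof -
  have "continuous_on orthant (\<lambda>v. h v * cutoff R v)"
    by (intro continuous_intros continuous_on_subset[OF assms(2)]) auto
  moreover have "\<forall>v\<in>orthant. 0 \<le> h v * cutoff R v"
    using assms(3) by (simp add: cutoff_nonneg)
  ultimately show ?thesis
    using assms(1) compact_cutoff_support[OF assms(4), of h] unfolding vague_limit_def by blast
qed

lemma radon_on_orthant_cutoff_finite:
  fixes M :: "(real^'n) measure"
  assumes M: "radon_on_orthant M" and R: "0 < R"
  shows "(\<integral>\<^sup>+ v. ennreal (cutoff R v) \<partial>M) < \<infinity>"
proof -
  have sets: "sets M = sets borel_orthant" using M by (simp add: radon_on_orthant_def)
  define K where "K = closure {v :: real^'n. v \<in> orthant \<and> (\<lambda>_. 1) v * cutoff R v \<noteq> 0}"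
  have K: "compact K" unfolding K_def by (rule compact_cutoff_support[OF R])
  have sub: "K \<subseteq> orthant"
    unfolding K_def by (intro closure_minimal) (auto simp: closed_atLeast)
  have "K \<inter> orthant \<in> sets M" using K by (intro sets_orthantI[OF sets] borel_compact)
  hence KM: "K \<in> sets M" using sub by (simp add: Int_absorb2)
  have "(\<integral>\<^sup>+ v. ennreal (cutoff R v) \<partial>M) \<le> (\<integral>\<^sup>+ v. indicator K v \<partial>M)"
  proof (rule nn_integral_mono)
    fix v :: "real^'n" assume "v \<in> space M"
    hence "v \<in> orthant" using space_eq_orthant[OF sets] by simp
    hence "cutoff R v \<noteq> 0 \<Longrightarrow> v \<in> K" unfolding K_def by (intro subsetD[OF closure_subset]) auto
    thus "ennreal (cutoff R v) \<le> indicator K v"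
      using cutoff_le_1[of R v] by (cases "cutoff R v = 0") (auto simp: indicator_def)
  qed
  also have "\<dots> = emeasure M K" using KM by simp
  also have "\<dots> < \<infinity>" by (rule radon_on_orthant_compact_finite[OF M K sub])
  finally show ?thesis .
qed

section \<open>The rescaled measures\<close>

lemma nn_integral_rescaled:
  fixes U :: "(real^'n) measure"
  assumes U: "sets U = sets borel_orthant" and b: "vpos (b t)" and f: "continuous_on UNIV f"
  shows "(\<integral>\<^sup>+ v. ennreal (f v) \<partial>rescaled U b t) =
         ennreal (1 / t) * (\<integral>\<^sup>+ u. ennreal (f (vrecip (b t) * u)) \<partial>U)"
proof -
  have "continuous_on UNIV (\<lambda>u. vrecip (b t) * u)"
    by (simp add: times_vec_def) (intro continuous_intros)
  hence "(\<lambda>u. vrecip (b t) * u) \<in> measurable U borel"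
    by (intro borel_measurable_orthant[OF U])
  hence g: "(\<lambda>u. vrecip (b t) * u) \<in> measurable U borel_orthant"
    using b by (intro measurable_restrict_space2)
      (auto simp: space_eq_orthant[OF U] vpos_def vrecip_def less_eq_vec_def less_imp_le)
  have m: "(\<lambda>v. ennreal (f v)) \<in> borel_measurable borel_orthant"
    using borel_measurable_orthant[OF refl f] by (rule measurable_compose) simp
  have "(\<integral>\<^sup>+ v. ennreal (f v) \<partial>rescaled U b t) =
    ennreal (1 / t) * (\<integral>\<^sup>+ v. ennreal (f v) \<partial>distr U borel_orthant (\<lambda>u. vrecip (b t) * u))"
    unfolding rescaled_def using m by (intro nn_integral_scale_measure) simp
  thus ?thesis using nn_integral_distr[OF g, of "\<lambda>v. ennreal (f v)"] m by simp
qed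

lemma laplace_rescaled:
  fixes U :: "(real^'n) measure"
  assumes "sets U = sets borel_orthant" and "vpos (b t)"
  shows "laplace (rescaled U b t) (vrecip x) = ennreal (1 / t) * laplace U (vrecip (b t * x))"
proof -
  have "vrecip x $ i * (vrecip (b t) * u) $ i = vrecip (b t * x) $ i * u $ i" for u i
    by (simp add: vrecip_def divide_inverse mult_ac)
  moreover have "continuous_on UNIV (\<lambda>v. exp (- (\<Sum>i\<in>UNIV. vrecip x $ i * v $ i)))"
    by (intro continuous_intros)
  ultimately show ?thesis
    unfolding laplace_def by (simp add: nn_integral_rescaled[of U b t, OF assms] del: vector_mult_component)
qed

text \<open>
  If every coordinate of \<open>b\<close> at least doubles between \<open>t\<close> and \<open>c t\<close>, then doubling a cutoff radius
  is dominated by moving from \<open>t\<close> to \<open>c t\<close>. The factor \<open>c\<close> is the change of the normalisation \<open>1/t\<close>.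
\<close>

lemma rescaled_cutoff_doubling:
  fixes U :: "(real^'n) measure"
  assumes U: "sets U = sets borel_orthant" and b: "vpos (b t)" "vpos (b (c * t))"
    and pos: "0 < c" "0 < t" "0 < R" and double: "\<And>i. 2 * b t $ i \<le> b (c * t) $ i"
  shows "(\<integral>\<^sup>+ v. ennreal (cutoff (2 * R) v) \<partial>rescaled U b t) \<le>
         ennreal c * (\<integral>\<^sup>+ v. ennreal (cutoff R v) \<partial>rescaled U b (c * t))"
proof -
  have *: "cutoff (2 * R) (vrecip (b t) * u) \<le> cutoff R (vrecip (b (c * t)) * u)"
    if "u \<in> space U" for u
  proof -
    have ui: "0 \<le> u $ i" for i using that space_eq_orthant[OF U] by (auto simp: less_eq_vec_def)
    have "coord_sum (vrecip (b (c * t)) * u) \<le> coord_sum (vrecip (b t) * u) / 2"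
      unfolding coord_sum_def sum_divide_distrib
    proof (rule sum_mono)
      fix i
      have "u $ i / b (c * t) $ i \<le> u $ i / (2 * b t $ i)"
        using double[of i] ui[of i] b by (intro divide_left_mono) (auto simp: vpos_def)
      thus "(vrecip (b (c * t)) * u) $ i \<le> (vrecip (b t) * u) $ i / 2"
        by (simp add: vrecip_def mult_ac)
    qed
    hence "coord_sum (vrecip (b (c * t)) * u) / R \<le> coord_sum (vrecip (b t) * u) / 2 / R"
      using pos by (intro divide_right_mono) auto
    thus ?thesis by (auto simp: cutoff_def)
  qed
  have eq: "ennreal (1 / t) = ennreal c * ennreal (1 / (c * t))"
    using pos by (simp flip: ennreal_mult)
  have "(\<integral>\<^sup>+ v. ennreal (cutoff (2 * R) v) \<partial>rescaled U b t)
      = ennreal (1 / t) * (\<integral>\<^sup>+ u. ennreal (cutoff (2 * R) (vrecip (b t) * u)) \<partial>U)"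
    by (intro nn_integral_rescaled[of U b t, OF U b(1)] continuous_intros)
  also have "\<dots> \<le> ennreal (1 / t) * (\<integral>\<^sup>+ u. ennreal (cutoff R (vrecip (b (c * t)) * u)) \<partial>U)"
    using * by (intro mult_left_mono nn_integral_mono ennreal_leI) auto
  also have "\<dots> = ennreal c * (\<integral>\<^sup>+ v. ennreal (cutoff R v) \<partial>rescaled U b (c * t))"
    unfolding eq by (subst nn_integral_rescaled[of U b "c * t", OF U b(2)])
      (auto intro!: continuous_intros simp: mult.assoc)
  finally show ?thesis .
qed

section \<open>Polynomial growth and the Laplace transform of the limit\<close>

text \<open>
  The choice \<open>c > 2 powr \<gamma> $ i\<close> makes every limiting ratio \<open>c powr (1 / \<gamma> $ i)\<close> exceed 2, and so, for
  large \<open>t\<close>, the ratio \<open>b (c * t) $ i / b t $ i\<close> itself.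
\<close>

lemma RV_eventually_doubling:
  fixes b :: "real \<Rightarrow> real^'n"
  assumes \<gamma>: "vpos \<gamma>" and b: "\<And>i. (\<lambda>t. b t $ i) \<in> RV (1 / \<gamma> $ i)"
  obtains c :: real where "0 < c" "\<forall>\<^sub>F t in at_top. \<forall>i. 2 * b t $ i \<le> b (c * t) $ i"
proof -
  have "\<forall>\<^sub>F c in at_top. 2 < c powr (1 / \<gamma> $ i)" for i
    using eventually_gt_at_top[of "2 powr \<gamma> $ i"]
  proof eventually_elim
    case (elim c)
    have g: "0 < \<gamma> $ i" using \<gamma> by (simp add: vpos_def)
    have "(2 powr \<gamma> $ i) powr (1 / \<gamma> $ i) < c powr (1 / \<gamma> $ i)"
      using elim g by (intro powr_less_mono2) auto
    thus ?case using g by (simp add: powr_powr)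
  qed
  hence "\<forall>\<^sub>F c in at_top. \<forall>i. 2 < c powr (1 / \<gamma> $ i)" by (rule eventually_all_finite)
  hence "\<forall>\<^sub>F c in at_top. 0 < c \<and> (\<forall>i. 2 < c powr (1 / \<gamma> $ i))"
    using eventually_gt_at_top by (rule eventually_conj[rotated])
  then obtain c :: real where c: "0 < c" "\<And>i. 2 < c powr (1 / \<gamma> $ i)"
    using eventually_happens trivial_limit_at_top_linorder by blast
  have "\<forall>\<^sub>F t in at_top. 2 * b t $ i \<le> b (c * t) $ i" for i
  proof -
    have "((\<lambda>t. b (c * t) $ i / b t $ i) \<longlongrightarrow> c powr (1 / \<gamma> $ i)) at_top"
      using b[of i] c by (simp add: RV_def)
    hence "\<forall>\<^sub>F t in at_top. 2 < b (c * t) $ i / b t $ i" using c(2) by (rule order_tendstoD)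
    with eventually_gt_at_top[of 0] show ?thesis
    proof eventually_elim
      case (elim t)
      have "0 < b t $ i" using b[of i] elim(1) by (simp add: RV_def)
      thus ?case using elim(2) by (simp add: field_simps)
    qed
  qed
  hence "\<forall>\<^sub>F t in at_top. \<forall>i. 2 * b t $ i \<le> b (c * t) $ i" by (rule eventually_all_finite)
  with c(1) show thesis by (rule that)
qed

text \<open>
  Along \<open>t\<close> and along \<open>c t\<close> the rescaled measures have the same limit, so the comparison between
  scales becomes a statement about that limit alone: doubling a radius multiplies its mass by at
  most \<open>c\<close>, which is polynomial growth.
\<close>

lemma vague_limit_rescaled_doubling:
  fixes b :: "real \<Rightarrow> real^'n" and U L :: "(real^'n) measure"
  assumes U: "sets U = sets borel_orthant" and b: "\<And>t. 0 < t \<Longrightarrow> vpos (b t)"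
    and lim: "vague_limit (rescaled U b) L at_top"
    and c: "0 < c" and double: "\<forall>\<^sub>F t in at_top. \<forall>i. 2 * b t $ i \<le> b (c * t) $ i"
    and R: "0 < R"
  shows "(\<integral>\<^sup>+ v. ennreal (cutoff (2 * R) v) \<partial>L) \<le> ennreal c * (\<integral>\<^sup>+ v. ennreal (cutoff R v) \<partial>L)"
proof (rule tendsto_le[OF trivial_limit_at_top_linorder])
  have lim': "((\<lambda>t. \<integral>\<^sup>+ v. ennreal (cutoff S v) \<partial>rescaled U b t) \<longlongrightarrow>
      (\<integral>\<^sup>+ v. ennreal (cutoff S v) \<partial>L)) at_top" if "0 < S" for S
    using vague_limit_cutoff[OF lim, of "\<lambda>_. 1" S] that by simp
  show "((\<lambda>t. \<integral>\<^sup>+ v. ennreal (cutoff (2 * R) v) \<partial>rescaled U b t) \<longlongrightarrow>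
      (\<integral>\<^sup>+ v. ennreal (cutoff (2 * R) v) \<partial>L)) at_top" using R by (intro lim') auto
  have "filterlim (\<lambda>t. c * t) at_top at_top"
    using c by (intro filterlim_tendsto_pos_mult_at_top[OF tendsto_const] filterlim_ident)
  hence "((\<lambda>t. \<integral>\<^sup>+ v. ennreal (cutoff R v) \<partial>rescaled U b (c * t)) \<longlongrightarrow>
      (\<integral>\<^sup>+ v. ennreal (cutoff R v) \<partial>L)) at_top"
    by (rule filterlim_compose[OF lim'[OF R]])
  thus "((\<lambda>t. ennreal c * (\<integral>\<^sup>+ v. ennreal (cutoff R v) \<partial>rescaled U b (c * t))) \<longlongrightarrow>
      ennreal c * (\<integral>\<^sup>+ v. ennreal (cutoff R v) \<partial>L)) at_top"
    by (intro ennreal_tendsto_cmult) auto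
  show "\<forall>\<^sub>F t in at_top. (\<integral>\<^sup>+ v. ennreal (cutoff (2 * R) v) \<partial>rescaled U b t) \<le>
      ennreal c * (\<integral>\<^sup>+ v. ennreal (cutoff R v) \<partial>rescaled U b (c * t))"
    using double eventually_gt_at_top[of 0]
    by eventually_elim (use c R in \<open>auto intro!: rescaled_cutoff_doubling[OF U] b\<close>)
qed

text \<open>
  The terms are \<open>c ^ n\<close>, a bound for the mass at radius \<open>2 ^ n\<close>, times a bound for the exponential
  weight \<open>exp (- m s)\<close> at \<open>s \<ge> 2 ^ n / 2\<close>.
\<close>

lemma summable_power_exp_power2:
  fixes c m :: real
  assumes c: "0 < c" and m: "0 < m"
  shows "summable (\<lambda>n. exp (m - m * 2 ^ n / 2) * c ^ n)"
proof -
  obtain N where N: "ln (2 * c) * 2 / m < 2 ^ N" using real_arch_pow[of 2] by auto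
  have small: "exp (- (m / 2 * 2 ^ n)) < 1 / (2 * c)" if "N \<le> n" for n
  proof -
    have "(2::real) ^ N \<le> 2 ^ n" using that by (intro power_increasing) auto
    with N have "ln (2 * c) * 2 / m < 2 ^ n" by (rule less_le_trans)
    hence "ln (2 * c) < m / 2 * 2 ^ n" using m by (simp add: field_simps)
    hence "exp (- (m / 2 * 2 ^ n)) < exp (- ln (2 * c))" by simp
    also have "\<dots> = 1 / (2 * c)" using c by (simp add: exp_minus inverse_eq_divide)
    finally show ?thesis .
  qed
  show ?thesis
  proof (rule summable_ratio_test[of "1/2" N])
    fix n assume "N \<le> n"
    from small[OF this] have "exp (- (m / 2 * 2 ^ n)) * c \<le> 1 / 2" using c by (simp add: field_simps)
    hence "exp (m - m * 2 ^ n / 2) * c ^ n * (exp (- (m / 2 * 2 ^ n)) * c)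
        \<le> exp (m - m * 2 ^ n / 2) * c ^ n * (1 / 2)" using c by (intro mult_left_mono) auto
    moreover have "exp (m - m * 2 ^ Suc n / 2) = exp (m - m * 2 ^ n / 2) * exp (- (m / 2 * 2 ^ n))"
      by (simp add: exp_add[symmetric])
    ultimately show "norm (exp (m - m * 2 ^ Suc n / 2) * c ^ Suc n)
        \<le> 1 / 2 * norm (exp (m - m * 2 ^ n / 2) * c ^ n)" using c by (simp add: mult_ac)
  qed simp
qed

lemma exp_le_suminf_cutoff:
  fixes v :: "real^'n"
  assumes m: "0 < m" and v: "0 \<le> v"
  shows "ennreal (exp (- (m * coord_sum v))) \<le>
         (\<Sum>n. ennreal (exp (m - m * 2 ^ n / 2)) * ennreal (cutoff (2 ^ n) v))"
proof -
  let ?s = "coord_sum v"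
  \<comment> \<open>The first dyadic radius whose cutoff is 1 at \<open>v\<close> satisfies \<open>2 ^ n \<le> 2 * coord_sum v\<close> unless
    \<open>n = 0\<close>; the factor \<open>exp m\<close> in the weights pays for that exception.\<close>
  define n where "n = (LEAST n. ?s \<le> 2 ^ n)"
  obtain k where "?s < 2 ^ k" using real_arch_pow[of 2 ?s] by auto
  hence "?s \<le> 2 ^ k" by simp
  hence n: "?s \<le> 2 ^ n" unfolding n_def by (rule LeastI)
  have "2 ^ n \<le> 2 + 2 * ?s"
  proof (cases n)
    case 0
    thus ?thesis using coord_sum_nonneg[OF v] by simp
  next
    case (Suc j)
    hence "\<not> ?s \<le> 2 ^ j" unfolding n_def by (metis lessI not_less_Least)
    thus ?thesis using Suc by simp
  qed
  hence "m * 2 ^ n \<le> m * (2 + 2 * ?s)" using m by (intro mult_left_mono) auto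
  hence "exp (- (m * ?s)) \<le> exp (m - m * 2 ^ n / 2)" by (simp add: algebra_simps)
  hence "ennreal (exp (- (m * ?s)))
      \<le> ennreal (exp (m - m * 2 ^ n / 2)) * ennreal (cutoff (2 ^ n) v)"
    using n by (simp add: cutoff_eq_1)
  also have "\<dots> = (\<Sum>k\<in>{n}. ennreal (exp (m - m * 2 ^ k / 2)) * ennreal (cutoff (2 ^ k) v))" by simp
  also have "\<dots> \<le> (\<Sum>k. ennreal (exp (m - m * 2 ^ k / 2)) * ennreal (cutoff (2 ^ k) v))"
    by (rule sum_le_suminf) auto
  finally show ?thesis .
qed

text \<open>
  Integrating the dyadic bound of the exponential gives a series in the masses at the radii
  \<open>2 ^ n\<close>, which grow at most like \<open>c ^ n\<close>.
\<close>

lemma laplace_finite_of_doubling: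
  fixes L :: "(real^'n) measure"
  assumes L: "radon_on_orthant L" and c: "0 < c"
    and double: "\<And>R. 0 < R \<Longrightarrow>
      (\<integral>\<^sup>+ v. ennreal (cutoff (2 * R) v) \<partial>L) \<le> ennreal c * (\<integral>\<^sup>+ v. ennreal (cutoff R v) \<partial>L)"
    and l: "vpos l"
  shows "laplace L l < \<infinity>"
proof -
  have sets: "sets L = sets borel_orthant" using L by (simp add: radon_on_orthant_def)
  define m where "m = Min (range (($) l))"
  have m: "0 < m" using l by (simp add: m_def vpos_def)
  have ml: "m \<le> l $ i" for i by (simp add: m_def)
  have meas: "(\<lambda>v. ennreal (cutoff R v)) \<in> borel_measurable L" for R
    by (rule measurable_compose[OF borel_measurable_orthant[OF sets continuous_on_cutoff]]) simp
  define I where "I R = (\<integral>\<^sup>+ v. ennreal (cutoff R v) \<partial>L)" for R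
  have pow: "I (2 ^ n) \<le> ennreal (c ^ n) * I 1" for n
  proof (induction n)
    case (Suc n)
    have "I (2 ^ Suc n) \<le> ennreal c * I (2 ^ n)" using double[of "2 ^ n"] by (simp add: I_def)
    also have "\<dots> \<le> ennreal c * (ennreal (c ^ n) * I 1)" by (intro mult_left_mono Suc) auto
    also have "\<dots> = ennreal (c ^ Suc n) * I 1" using c by (simp add: ennreal_mult mult.assoc)
    finally show ?case .
  qed simp
  have "laplace L l \<le> (\<integral>\<^sup>+ v. (\<Sum>n. ennreal (exp (m - m * 2 ^ n / 2)) * ennreal (cutoff (2 ^ n) v)) \<partial>L)"
    unfolding laplace_def
  proof (rule nn_integral_mono)
    fix v assume "v \<in> space L"
    hence v: "0 \<le> v" using space_eq_orthant[OF sets] by simp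
    have "m * coord_sum v \<le> (\<Sum>i\<in>UNIV. l $ i * v $ i)"
      unfolding coord_sum_def sum_distrib_left
      using v ml by (intro sum_mono mult_right_mono) (auto simp: less_eq_vec_def)
    hence "ennreal (exp (- (\<Sum>i\<in>UNIV. l $ i * v $ i))) \<le> ennreal (exp (- (m * coord_sum v)))"
      by (intro ennreal_leI) simp
    also note exp_le_suminf_cutoff[OF m v]
    finally show "ennreal (exp (- (\<Sum>i\<in>UNIV. l $ i * v $ i)))
      \<le> (\<Sum>n. ennreal (exp (m - m * 2 ^ n / 2)) * ennreal (cutoff (2 ^ n) v))" .
  qed
  also have "\<dots> = (\<Sum>n. ennreal (exp (m - m * 2 ^ n / 2)) * I (2 ^ n))"
    using meas by (simp add: nn_integral_suminf nn_integral_cmult I_def)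
  also have "\<dots> \<le> (\<Sum>n. ennreal (exp (m - m * 2 ^ n / 2) * c ^ n) * I 1)"
  proof (rule suminf_le)
    fix n
    have "ennreal (exp (m - m * 2 ^ n / 2)) * I (2 ^ n)
        \<le> ennreal (exp (m - m * 2 ^ n / 2)) * (ennreal (c ^ n) * I 1)"
      by (intro mult_left_mono pow) auto
    thus "ennreal (exp (m - m * 2 ^ n / 2)) * I (2 ^ n) \<le> ennreal (exp (m - m * 2 ^ n / 2) * c ^ n) * I 1"
      using c by (simp add: ennreal_mult mult.assoc)
  qed auto
  also have "\<dots> = (\<Sum>n. ennreal (exp (m - m * 2 ^ n / 2) * c ^ n)) * I 1" by simp
  also have "\<dots> < \<infinity>"
  proof -
    have "(\<Sum>n. ennreal (exp (m - m * 2 ^ n / 2) * c ^ n)) \<noteq> top"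
      using c m by (intro ennreal_suminf_neq_top summable_power_exp_power2) auto
    moreover have "I 1 < \<infinity>" using radon_on_orthant_cutoff_finite[OF L, of 1] by (simp add: I_def)
    ultimately show ?thesis by (simp add: ennreal_mult_less_top less_top)
  qed
  finally show ?thesis .
qed

section \<open>Convergence of the Laplace transforms\<close>

text \<open>
  Multiplied by a cutoff, the exponential is a test function for vague convergence. For the lower
  bound the cutoff is removed by monotone convergence on the side of \<open>L\<close>; for the upper bound the
  error lies where some coordinate is large, and the tail condition makes it small for all large \<open>t\<close>.
\<close>

lemma laplace_tendsto_of_vague_limit:
  fixes M :: "real \<Rightarrow> (real^'n) measure" and L :: "(real^'n) measure"
  assumes M: "\<And>t. sets (M t) = sets borel_orthant" and L: "sets L = sets borel_orthant"
    and lim: "vague_limit M L at_top"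
    and fin: "laplace L (vrecip x) < \<infinity>"
    and tail: "((\<lambda>y. Limsup at_top (\<lambda>t. \<integral>\<^sup>+ v \<in> {v \<in> orthant. \<exists>i. v $ i > y}.
                   ennreal (exp (- (\<Sum>i\<in>UNIV. v $ i / x $ i))) \<partial>M t)) \<longlongrightarrow> 0) at_top"
  shows "((\<lambda>t. laplace (M t) (vrecip x)) \<longlongrightarrow> laplace L (vrecip x)) at_top"
proof -
  define h where "h v = exp (- (\<Sum>i\<in>UNIV. v $ i / x $ i))" for v :: "real^'n"
  have h: "continuous_on UNIV h" unfolding h_def divide_inverse by (intro continuous_intros)
  have h0: "0 \<le> h v" for v by (simp add: h_def)
  have lap: "laplace N (vrecip x) = (\<integral>\<^sup>+ v. ennreal (h v) \<partial>N)" for N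
    by (simp add: laplace_def h_def vrecip_def)
  have trunc_le: "(\<integral>\<^sup>+ v. ennreal (h v * cutoff R v) \<partial>N) \<le> laplace N (vrecip x)" for R N
    unfolding lap using h0 cutoff_le_1 by (intro nn_integral_mono ennreal_leI mult_left_le)
  have limR: "((\<lambda>t. \<integral>\<^sup>+ v. ennreal (h v * cutoff R v) \<partial>M t) \<longlongrightarrow>
          (\<integral>\<^sup>+ v. ennreal (h v * cutoff R v) \<partial>L)) at_top" if "0 < R" for R
    using vague_limit_cutoff[OF lim h h0 that] .
  define T where "T y t = (\<integral>\<^sup>+ v \<in> {v \<in> orthant. \<exists>i. v $ i > y}. ennreal (h v) \<partial>M t)" for y t
  have split: "laplace (M t) (vrecip x) \<le>
      (\<integral>\<^sup>+ v. ennreal (h v * cutoff (real CARD('n) * y) v) \<partial>M t) + T y t" if y: "0 < y" for y t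
  proof -
    let ?R = "real CARD('n) * y" and ?A = "{v \<in> orthant. \<exists>i. v $ i > y} :: (real^'n) set"
    have m1: "(\<lambda>v. ennreal (h v * cutoff ?R v)) \<in> borel_measurable (M t)"
      by (rule measurable_compose[OF borel_measurable_orthant[OF M]])
        (intro continuous_intros h, simp)
    have "{v. \<exists>i. v $ i > y} \<in> sets (borel :: (real^'n) measure)"
      unfolding Collect_ex_eq
      by (intro borel_open open_UN ballI open_Collect_less continuous_intros)
    hence "{v. \<exists>i. v $ i > y} \<inter> orthant \<in> sets (M t)" by (rule sets_orthantI[OF M])
    also have "{v. \<exists>i. v $ i > y} \<inter> orthant = ?A" by auto
    finally have A: "?A \<in> sets (M t)" .
    have m2: "(\<lambda>v. ennreal (h v) * indicator ?A v) \<in> borel_measurable (M t)"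
      using A measurable_compose[OF borel_measurable_orthant[OF M h], of ennreal] by measurable
    have "laplace (M t) (vrecip x)
        \<le> (\<integral>\<^sup>+ v. ennreal (h v * cutoff ?R v) + ennreal (h v) * indicator ?A v \<partial>M t)"
      unfolding lap
    proof (rule nn_integral_mono)
      fix v :: "real^'n" assume "v \<in> space (M t)"
      hence v: "v \<in> orthant" using space_eq_orthant[OF M] by simp
      show "ennreal (h v) \<le> ennreal (h v * cutoff ?R v) + ennreal (h v) * indicator ?A v"
      proof (cases "v \<in> ?A")
        case False
        \<comment> \<open>All coordinates are at most \<open>y\<close>, which is why the radius is \<open>CARD('n) * y\<close>.\<close>
        hence "coord_sum v \<le> ?R" unfolding coord_sum_def using v
          by (intro sum_bounded_above) (auto simp: not_less)
        thus ?thesis using y by (simp add: cutoff_eq_1)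
      qed simp
    qed
    also have "\<dots> = (\<integral>\<^sup>+ v. ennreal (h v * cutoff ?R v) \<partial>M t) + T y t"
      unfolding T_def by (rule nn_integral_add[OF m1 m2])
    finally show ?thesis .
  qed
  show ?thesis
  proof (rule order_tendstoI)
    fix a assume a: "a < laplace L (vrecip x)"
    have "(\<lambda>n. \<integral>\<^sup>+ v. ennreal (h v * cutoff (real (Suc n)) v) \<partial>L) \<longlonglongrightarrow> laplace L (vrecip x)"
      unfolding lap
    proof (rule nn_integral_LIMSEQ)
      show "incseq (\<lambda>n v. ennreal (h v * cutoff (real (Suc n)) v))"
        using h0 by (auto simp: incseq_def le_fun_def intro!: ennreal_leI mult_left_mono cutoff_mono)
      show "(\<lambda>v. ennreal (h v * cutoff (real (Suc n)) v)) \<in> borel_measurable L" for n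
        by (rule measurable_compose[OF borel_measurable_orthant[OF L]])
          (intro continuous_intros h, simp)
      show "(\<lambda>n. ennreal (h v * cutoff (real (Suc n)) v)) \<longlonglongrightarrow> ennreal (h v)" for v
        using tendsto_mult[OF tendsto_const tendsto_cutoff, of "h v" v]
        by (intro tendsto_ennrealI) simp
    qed
    hence "\<forall>\<^sub>F n in sequentially. a < (\<integral>\<^sup>+ v. ennreal (h v * cutoff (real (Suc n)) v) \<partial>L)"
      using a by (rule order_tendstoD)
    then obtain n where "a < (\<integral>\<^sup>+ v. ennreal (h v * cutoff (real (Suc n)) v) \<partial>L)"
      by (auto simp: eventually_sequentially)
    hence "\<forall>\<^sub>F t in at_top. a < (\<integral>\<^sup>+ v. ennreal (h v * cutoff (real (Suc n)) v) \<partial>M t)"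
      by (intro order_tendstoD[OF limR]) auto
    thus "\<forall>\<^sub>F t in at_top. a < laplace (M t) (vrecip x)"
      by eventually_elim (use trunc_le in \<open>auto intro: less_le_trans\<close>)
  next
    fix a assume "laplace L (vrecip x) < a"
    then obtain a' where a': "laplace L (vrecip x) < a'" "a' < a" using dense by blast
    obtain l where l: "laplace L (vrecip x) = ennreal l" "0 \<le> l"
      using fin by (cases "laplace L (vrecip x)") auto
    obtain r where r: "a' = ennreal r" "0 \<le> r" using a'(2) by (cases a') auto
    have lr: "l < r" using a'(1) l r by (simp add: ennreal_less_iff)
    define e where "e = (r - l) / 2"
    have e: "0 < e" "l + e + e = r" using lr by (auto simp: e_def)
    have "\<forall>\<^sub>F y in at_top. Limsup at_top (T y) < ennreal e"
      using tail e(1) unfolding T_def h_def by (intro order_tendstoD) auto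
    hence "\<forall>\<^sub>F y in at_top. 0 < y \<and> Limsup at_top (T y) < ennreal e"
      using eventually_gt_at_top by (rule eventually_conj[rotated])
    then obtain y where y: "0 < y" "Limsup at_top (T y) < ennreal e"
      using eventually_happens trivial_limit_at_top_linorder by blast
    let ?R = "real CARD('n) * y"
    have "(\<integral>\<^sup>+ v. ennreal (h v * cutoff ?R v) \<partial>L) < ennreal (l + e)"
      using trunc_le[of L ?R] l e by (auto simp: ennreal_less_iff intro: le_less_trans)
    hence "\<forall>\<^sub>F t in at_top. (\<integral>\<^sup>+ v. ennreal (h v * cutoff ?R v) \<partial>M t) < ennreal (l + e)"
      using y by (intro order_tendstoD[OF limR]) auto
    with Limsup_lessD[OF y(2)] show "\<forall>\<^sub>F t in at_top. laplace (M t) (vrecip x) < a"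
    proof eventually_elim
      case (elim t)
      have "laplace (M t) (vrecip x) \<le> ennreal (l + e) + ennreal e"
        using split[OF y(1), of t] elim by (meson add_mono less_imp_le order_trans)
      also have "\<dots> = a'" using l e r by (simp flip: ennreal_plus)
      also note a'(2)
      finally show ?case .
    qed
  qed
qed

theorem proposition1:
  fixes \<gamma> :: "real^'n"
    and b :: "real \<Rightarrow> real^'n"
    and U Uinf :: "(real^'n) measure"
  assumes "vpos \<gamma>"
    and "\<And>i. (\<lambda>t. b t $ i) \<in> RV (1 / \<gamma> $ i)"
    and "sets U = sets borel_orthant"
    and "\<And>l. vpos l \<Longrightarrow> laplace U l < \<infinity>"
    and "radon_on_orthant Uinf"
    and "emeasure Uinf orthant \<noteq> 0"
    and "vague_limit (rescaled U b) Uinf at_top"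
  shows "(\<exists>W. radon_on_orthant W \<and>
            (\<forall>x. vpos x \<longrightarrow> emeasure W {0..x} = laplace U (vrecip x))) \<and>
         (\<exists>Winf. radon_on_orthant Winf \<and>
            (\<forall>x. vpos x \<longrightarrow> emeasure Winf {0..x} = laplace Uinf (vrecip x))) \<and>
         ((\<forall>x. vpos x \<longrightarrow>
             ((\<lambda>y. Limsup at_top (\<lambda>t.
                 \<integral>\<^sup>+ v \<in> {v \<in> orthant. \<exists>i. v $ i > y}.
                   ennreal (exp (- (\<Sum>i\<in>UNIV. v $ i / x $ i))) \<partial>rescaled U b t))
               \<longlongrightarrow> 0) at_top) \<longrightarrow>
          (\<forall>x. vpos x \<longrightarrow>
             ((\<lambda>t. ennreal (1 / t) * laplace U (vrecip (b t * x)))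
               \<longlongrightarrow> laplace Uinf (vrecip x)) at_top))"
proof (intro conjI impI allI)
  have bpos: "vpos (b t)" if "0 < t" for t using assms(2) that by (simp add: vpos_def RV_def)
  obtain c where c: "0 < c" "\<forall>\<^sub>F t in at_top. \<forall>i. 2 * b t $ i \<le> b (c * t) $ i"
    using RV_eventually_doubling[OF assms(1,2)] by blast
  have setsL: "sets Uinf = sets borel_orthant" using assms(5) by (simp add: radon_on_orthant_def)
  have fin: "laplace Uinf l < \<infinity>" if "vpos l" for l
    using laplace_finite_of_doubling[OF assms(5) c(1) _ that]
      vague_limit_rescaled_doubling[OF assms(3) bpos assms(7) c] by blast
  show "\<exists>W. radon_on_orthant W \<and> (\<forall>x. vpos x \<longrightarrow> emeasure W {0..x} = laplace U (vrecip x))"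
    using assms(3,4) by (rule laplace_vrecip_distribution)
  show "\<exists>Winf. radon_on_orthant Winf \<and>
      (\<forall>x. vpos x \<longrightarrow> emeasure Winf {0..x} = laplace Uinf (vrecip x))"
    using setsL fin by (rule laplace_vrecip_distribution)
  fix x :: "real^'n"
  assume tail: "\<forall>x. vpos x \<longrightarrow>
             ((\<lambda>y. Limsup at_top (\<lambda>t.
                 \<integral>\<^sup>+ v \<in> {v \<in> orthant. \<exists>i. v $ i > y}.
                   ennreal (exp (- (\<Sum>i\<in>UNIV. v $ i / x $ i))) \<partial>rescaled U b t))
               \<longlongrightarrow> 0) at_top"
    and x: "vpos x"
  have "vpos (vrecip x)" using x by (simp add: vpos_def vrecip_def)
  hence "((\<lambda>t. laplace (rescaled U b t) (vrecip x)) \<longlongrightarrow> laplace Uinf (vrecip x)) at_top"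
    using tail x
    by (intro laplace_tendsto_of_vague_limit[OF _ setsL assms(7)] fin) (auto simp: sets_rescaled)
  thus "((\<lambda>t. ennreal (1 / t) * laplace U (vrecip (b t * x))) \<longlongrightarrow> laplace Uinf (vrecip x)) at_top"
    by (rule Lim_transform_eventually)
      (use eventually_gt_at_top[of 0] in
        \<open>eventually_elim, auto intro!: laplace_rescaled assms(3) bpos\<close>)
qed

end
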